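(* Let $f:\mathbb{N}\to\mathbb{N}$ satisfy $f(0)=f(1)=1$. Then an integer $n>1$ is prime if and only if $m$ divides $\binom{m}{n-2m}_f$ for all integers $m$ with $0\le 2m\le n$.
   Context: $\mathbb{N}=\{0,1,2,\dots\}$. For a function $f:\mathbb{N}\to\mathbb{N}$ and integers $k,n\ge 0$, the extended binomial coefficient $\binom{k}{n}_{f}$ is the coefficient of $x^n$ in the formal power series $\bigl(\sum_{s\in\mathbb{N}} f(s)x^s\bigr)^k$ (so $\binom{0}{n}_f=1$ if $n=0$ and $0$ otherwise). The integer $0$ divides an integer $a$ if and only if $a=0$. *)

theory Defs
  imports "HOL-Computational_Algebra.Computational_Algebra"
begin

definition ext_binom :: "(nat \<Rightarrow> nat) \<Rightarrow> nat \<Rightarrow> nat \<Rightarrow> nat" where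
  "ext_binom f k n = fps_nth (Abs_fps f ^ k) n"

end

theory Submission
  imports Defs
begin

text \<open>
  Write \<open>F\<close> for the power series of \<open>f\<close>. Differentiating \<open>F\<^sup>k\<close> gives
  \<open>n [x\<^sup>n] F\<^sup>k = k [x\<^sup>n\<^sup>-\<^sup>1] F' F\<^sup>k\<^sup>-\<^sup>1\<close>, so \<open>k\<close> divides the coefficient whenever \<open>k\<close> and \<open>n\<close>
  are coprime; this settles the case of prime \<open>n\<close>. If \<open>n > 2\<close> is even, \<open>m = n div 2\<close> fails.
  If \<open>n = p (2k + 1)\<close> with \<open>p\<close> prime and \<open>k > 0\<close>, take \<open>m = pk\<close>: the coefficient is \<open>k A\<close> with
  \<open>A = [x\<^sup>p\<^sup>-\<^sup>1] F' F\<^sup>p\<^sup>k\<^sup>-\<^sup>1\<close>. Since \<open>F\<^sup>p\<close> is \<open>1\<close> modulo \<open>p\<close> and \<open>x\<^sup>p\<close>, the residue of \<open>A\<close>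
  modulo \<open>p\<close> does not depend on \<open>k\<close>, and for \<open>k = 1\<close> it is \<open>[x\<^sup>p] F\<^sup>p\<close>, which is \<open>f(1)\<^sup>p = 1\<close>
  modulo \<open>p\<close>. Hence \<open>pk\<close> does not divide \<open>k A\<close>.
\<close>

lemma fps_nth_power_deriv:
  fixes F :: "'a::comm_semiring_1 fps"
  shows "of_nat (Suc n) * fps_nth (F ^ Suc k) (Suc n) =
         of_nat (Suc k) * fps_nth (fps_deriv F * F ^ k) n"
proof -
  have "fps_deriv (F ^ Suc k) = of_nat (Suc k) * (fps_deriv F * F ^ k)"
    by (induction k) (simp_all add: algebra_simps)
  then have "fps_nth (fps_deriv (F ^ Suc k)) n = fps_nth (of_nat (Suc k) * (fps_deriv F * F ^ k)) n"
    by (rule arg_cong)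
  then show ?thesis
    by (simp add: fps_of_nat [symmetric] del: of_nat_Suc power_Suc)
qed

lemma dvd_ext_binom:
  assumes "coprime k n"
  shows "k dvd ext_binom f k n"
proof (cases "k = 0 \<or> n = 0")
  case True
  \<comment> \<open>Coprimality leaves \<open>k = 0, n = 1\<close>, where the coefficient is
    \<open>0\<close>, or \<open>k = 1\<close>.\<close>
  with assms show ?thesis
    by (auto simp: ext_binom_def)
next
  case False
  then obtain i j where "k = Suc i" "n = Suc j"
    by (meson not0_implies_Suc)
  then have "k dvd n * ext_binom f k n"
    using fps_nth_power_deriv[of j "Abs_fps f" i]
    by (metis dvd_triv_left ext_binom_def of_nat_id)
  with assms show ?thesis
    by (simp add: coprime_dvd_mult_right_iff)
qed

text \<open>Expand \<open>(1 + B) ^ p\<close> with \<open>B = fps_X * fps_shift 1 F\<close>: the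
  prime \<open>p\<close> divides all middle binomial coefficients. The explicit \<open>H\<close>
  stands in for a congruence, as a semiring has no subtraction.\<close>

lemma prime_power_fps_decomp:
  fixes F :: "'a::comm_semiring_1 fps"
  assumes "prime p" and "fps_nth F 0 = 1"
  obtains H where "F ^ p = 1 + fps_X ^ p * fps_shift 1 F ^ p + of_nat p * H"
proof -
  define B where "B = fps_X * fps_shift 1 F"
  have F: "F = B + 1"
  proof (rule fps_ext)
    fix n show "fps_nth F n = fps_nth (B + 1) n"
      using assms(2) by (cases n) (simp_all add: B_def)
  qed
  have p: "p > 0" using assms(1) prime_gt_0_nat by blast
  have "of_nat p dvd (\<Sum>k\<in>{0<..<p}. of_nat (p choose k) * B ^ k :: 'a fps)"
  proof (rule dvd_sum)
    fix k assume k: "k \<in> {0<..<p}"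
    then have "p dvd p choose k"
      using assms(1) by (intro dvd_choose_prime) auto
    then obtain c where "p choose k = p * c" ..
    then have "of_nat (p choose k) * B ^ k = of_nat p * (of_nat c * B ^ k)"
      by (simp add: mult.assoc)
    then show "of_nat p dvd of_nat (p choose k) * B ^ k" ..
  qed
  then obtain H where H: "(\<Sum>k\<in>{0<..<p}. of_nat (p choose k) * B ^ k) = of_nat p * H" ..
  have set: "{..p} = insert 0 (insert p {0<..<p})" using p by auto
  have "F ^ p = (\<Sum>k\<le>p. of_nat (p choose k) * B ^ k)"
    by (simp add: F binomial_ring)
  also have "\<dots> = 1 + B ^ p + of_nat p * H"
    unfolding set using p H by (simp add: add.assoc)
  finally show thesis
    using that by (simp add: B_def power_mult_distrib)
qed

text \<open>The \<open>fps_X ^ p\<close> term of the decomposition does not reach degrees below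
  \<open>p\<close>.\<close>

lemma prime_power_fps_nth_cong:
  fixes F G :: "nat fps"
  assumes "prime p" and "fps_nth F 0 = 1" and "n < p"
  shows "fps_nth (G * F ^ p) n mod p = fps_nth G n mod p"
proof -
  obtain H where H: "F ^ p = 1 + fps_X ^ p * fps_shift 1 F ^ p + of_nat p * H"
    using prime_power_fps_decomp assms by blast
  have "G * F ^ p = G + fps_X ^ p * (G * fps_shift 1 F ^ p) + of_nat p * (G * H)"
    unfolding H by (simp add: algebra_simps)
  then have "fps_nth (G * F ^ p) n = fps_nth G n + p * fps_nth (G * H) n"
    using assms(3) by (simp add: fps_X_power_mult_nth fps_of_nat [symmetric])
  then show ?thesis by simp
qed

text \<open>In degree \<open>p\<close>, that term contributes just the constant coefficient of
  \<open>fps_shift 1 F ^ p\<close>.\<close>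

lemma prime_power_fps_nth_prime:
  fixes F :: "nat fps"
  assumes "prime p" and "fps_nth F 0 = 1"
  shows "fps_nth (F ^ p) p mod p = fps_nth F 1 ^ p mod p"
proof -
  obtain H where H: "F ^ p = 1 + fps_X ^ p * fps_shift 1 F ^ p + of_nat p * H"
    using prime_power_fps_decomp assms by blast
  have "p > 0" using assms(1) prime_gt_0_nat by blast
  then have "fps_nth (F ^ p) p = fps_nth F 1 ^ p + p * fps_nth H p"
    unfolding H by (simp add: fps_X_power_mult_nth fps_of_nat [symmetric] fps_nth_power_0)
  then show ?thesis by simp
qed

lemma prime_mult_not_dvd_ext_binom:
  assumes "prime p" and "k > 0" and "f 0 = 1" and "f 1 = 1"
  shows "\<not> p * k dvd ext_binom f (p * k) p"
proof -
  define F where "F = Abs_fps f"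
  \<comment> \<open>\<open>A j\<close> belongs to the multiplier \<open>k = Suc j\<close>, so the
    induction starts at \<open>k = 1\<close>.\<close>
  define A where "A j = fps_nth (fps_deriv F * F ^ (p * Suc j - 1)) (p - 1)" for j
  have F0: "fps_nth F 0 = 1" and F1: "fps_nth F 1 = 1" using assms by (simp_all add: F_def)
  have p: "p > 1" using assms(1) prime_gt_1_nat by blast
  have coeff: "fps_nth (F ^ (p * Suc j)) p = Suc j * A j" for j
  proof -
    \<comment> \<open>Degree \<open>p\<close> and exponent \<open>p * Suc j\<close> share the factor
      \<open>p\<close>, which cancels.\<close>
    have "p * fps_nth (F ^ (p * Suc j)) p = p * (Suc j * A j)"
      using fps_nth_power_deriv[of "p - 1" F "p * Suc j - 1"] p
      by (simp add: A_def mult.assoc del: mult_Suc_right power_Suc)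
    with p show ?thesis by simp
  qed
  have "A j mod p = 1" for j
  proof (induction j)
    case 0
    have "A 0 mod p = fps_nth (F ^ p) p mod p" using coeff[of 0] by simp
    also have "\<dots> = 1"
      using prime_power_fps_nth_prime[OF assms(1) F0] p by (simp add: F1[simplified])
    finally show ?case .
  next
    case (Suc j)
    have "p * Suc (Suc j) - 1 = (p * Suc j - 1) + p" using p by simp
    then have "A (Suc j) = fps_nth (fps_deriv F * F ^ (p * Suc j - 1) * F ^ p) (p - 1)"
      unfolding A_def by (simp only: power_add mult.assoc)
    then show ?case
      using prime_power_fps_nth_cong[OF assms(1) F0, of "p - 1"] p Suc.IH by (simp add: A_def)
  qed
  then have "\<not> p dvd A (k - 1)" by (simp add: dvd_eq_mod_eq_0)
  moreover have "ext_binom f (p * k) p = A (k - 1) * k"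
    using coeff[of "k - 1"] assms(2) by (simp add: ext_binom_def F_def)
  ultimately show ?thesis using assms(2) by simp
qed

theorem theorem34:
  fixes f :: "nat \<Rightarrow> nat" and n :: nat
  assumes "f 0 = 1" and "f 1 = 1" and "n > 1"
  shows "prime n \<longleftrightarrow> (\<forall>m::nat. 2 * m \<le> n \<longrightarrow> m dvd ext_binom f m (n - 2 * m))"
proof
  assume n: "prime n"
  show "\<forall>m::nat. 2 * m \<le> n \<longrightarrow> m dvd ext_binom f m (n - 2 * m)"
  proof (intro allI impI)
    fix m :: nat assume m: "2 * m \<le> n"
    show "m dvd ext_binom f m (n - 2 * m)"
    proof (cases "m = 0")
      case True
      with assms(3) show ?thesis by (simp add: ext_binom_def)
    next
      case False
      \<comment> \<open>Here \<open>0 < m < n\<close>.\<close>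
      then have "\<not> n dvd m" using m by (auto dest: dvd_imp_le)
      then have "coprime m n"
        using n prime_imp_coprime coprime_commute by blast
      moreover have "n = (n - 2 * m) + 2 * m" using m by simp
      ultimately have "coprime m (n - 2 * m)"
        by (metis coprime_iff_gcd_eq_1 gcd_add_mult mult.commute add.commute)
      then show ?thesis by (rule dvd_ext_binom)
    qed
  qed
next
  assume dvd: "\<forall>m::nat. 2 * m \<le> n \<longrightarrow> m dvd ext_binom f m (n - 2 * m)"
  show "prime n"
  proof (cases "even n")
    case True
    then obtain m where m: "n = 2 * m" ..
    with dvd have "m dvd ext_binom f m 0" by force
    \<comment> \<open>The constant coefficient of the power is \<open>1\<close>, so \<open>m\<close>
      divides \<open>1\<close>.\<close>
    then have "m = 1" using assms(1) by (simp add: ext_binom_def fps_nth_power_0)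
    with m show ?thesis by simp
  next
    case False
    obtain p where p: "prime p" "p dvd n"
      using assms(3) prime_factor_nat[of n] by auto
    then obtain q where q: "n = p * q" by blast
    with False have "odd q" by simp
    then obtain k where k: "q = 2 * k + 1" by (elim oddE)
    have "k = 0"
    proof (rule ccontr)
      assume "k \<noteq> 0"
      moreover have "n = 2 * (p * k) + p" unfolding q k by simp
      then have "p * k dvd ext_binom f (p * k) p"
        using dvd[rule_format, of "p * k"] by simp
      ultimately show False
        using prime_mult_not_dvd_ext_binom[of p k f] p(1) assms by simp
    qed
    with p(1) q k show ?thesis by simp
  qed
qed

end
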